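(* In the call-by-value $\lambda$-calculus, the set $\mathcal F=\{\mathrm{refl},\mathrm{lam},\mathrm{subst},\mathrm{ectx},\mathrm{id},\mathrm{red}\}$ of functions on relations is diacritically compatible, and $\mathrm{strong}(\mathcal F)=\mathcal F\setminus\{\mathrm{ectx}\}$.
   Context: Call-by-value $\lambda$-calculus: terms $t,s ::= v \mid t\,s$, values $v,w ::= x \mid \lambda x.t$ (terms modulo $\alpha$-conversion; $t\{v/x\}$ is capture-avoiding substitution), evaluation contexts $E ::= [\,] \mid E\,t \mid v\,E$. Reduction: $E[(\lambda x.t)\,v]\to E[t\{v/x\}]$; $\to^*$ is its reflexive-transitive closure; $t\Downarrow s$ means $t\to^* s$ and $s$ is irreducible. A variable is fresh if it does not occur in the terms/contexts under consideration. For a relation $R$ on terms: $v \mathrel{R^{v}} w$ iff $(v\,x)\mathrel R (w\,x)$ for a fresh $x$; $E\mathrel{R^{E}}E'$ iff $E[x]\mathrel R E'[x]$ for a fresh $x$; $E[x\,v]\mathrel{R^{o}}E'[x\,w]$ iff $E\mathrel{R^E}E'$ and $v\mathrel{R^v}w$. Diacritical progress: $R\rightsquigarrow S,T$ iff $R\subseteq S\subseteq T$ and whenever $t\mathrel R s$: (i) if $t\to t'$ then there is $s'$ with $s\to^*s'$ and $t'\mathrel T s'$; (ii) if $t$ is a value $v$ then $s\Downarrow w$ for some value $w$ with $v\mathrel{S^v}w$; (iii) if $t=E[x\,v]$ then $s\Downarrow E'[x\,w]$ for some $E',w$ with $E[x\,v]\mathrel{T^o}E'[x\,w]$; (iv)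 the symmetric conditions with the roles of $t$ and $s$ exchanged. Functions on relations: $\mathrm{id}(R)=R$; $(f\cup g)(R)=f(R)\cup g(R)$; $(f\circ g)(R)=f(g(R))$; $f^\omega=\bigcup_{n\in\mathbb N}f^n$ with $f^0=\mathrm{id}$; $\hat f=f\cup\mathrm{id}$; a set $\mathcal G$ of functions is identified with the function $\bigcup_{f\in\mathcal G}f$. $f$ is continuous if $f(R)\subseteq\bigcup\{f(S)\mid S\subseteq R,\ S\text{ finite}\}$ for all $R$. $f$ evolves to $g,h$ if for all $R,T$ with $R\rightsquigarrow R,T$ we have $f(R)\rightsquigarrow g(R),h(T)$; $f$ strongly evolves to $g,h$ if for all $R,S,T$ with $R\rightsquigarrow S,T$ we have $f(R)\rightsquigarrow g(S),h(T)$. A set $\mathcal F$ of continuous functions is diacritically compatible if it has a subset $\mathcal S$ such that every $f\in\mathcal S$ strongly evolves to $\hat{\mathcal S}^\omega,\hat{\mathcal F}^\omega$, and every $f\in\mathcal F$ evolves to $\hat{\mathcal S}^\omega\circ\hat{\mathcal F}\circ\hat{\mathcal S}^\omega,\ \hat{\mathcal F}^\omega$. The union of all subsets satisfying these conditions also satisfies them; it is denoted $\mathrm{strong}(\mathcal F)$. The specific functions: $\mathrm{refl}(R)=\{(t,t)\mid t\text{ a term}\}$; $\mathrm{lam}(R)=\{(\lambda x.t,\lambda x.s)\mid t\mathrel R s\}$; $\mathrm{subst}(R)=\{(t\{v/x\},s\{w/x\})\mid t\mathrel R s,\ v\mathrel{R^v}w\}$; $\mathrm{ectx}(R)=\{(E[t],E'[s])\mid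 t\mathrel R s,\ E\mathrel{R^E}E'\}$; $\mathrm{red}(R)=\{(t,s)\mid t\to^*t',\ s\to^*s',\ t'\mathrel R s'\}$. *)

theory Defs
  imports Main
begin

text \<open>
  Terms modulo alpha-conversion are represented by de Bruijn terms in which the free variable
  named \<open>n\<close> (names are the natural numbers) occurs under \<open>k\<close> binders as \<open>Var (n + k)\<close>. Every
  element of the datatypes is thus an alpha-equivalence class and no well-formedness predicate is
  needed. Named abstraction \<open>Abs x t\<close> and named substitution are derived, and everything
  below the section on substitution is stated through them only.
\<close>

datatype tm = Val vl | App tm tm
     and vl = Var nat | Lam tm

primrec fv :: "tm \<Rightarrow> nat set" and fvv :: "vl \<Rightarrow> nat set" where
  "fv (Val v) = fvv v"
| "fv (App t s) = fv t \<union> fv s"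
| "fvv (Var n) = {n}"
| "fvv (Lam t) = Suc -` fv t"

section \<open>Abstraction and substitution\<close>

definition up_ren :: "(nat \<Rightarrow> nat) \<Rightarrow> nat \<Rightarrow> nat" where
  "up_ren r = case_nat 0 (\<lambda>n. Suc (r n))"

primrec ren :: "tm \<Rightarrow> (nat \<Rightarrow> nat) \<Rightarrow> tm" and renv :: "vl \<Rightarrow> (nat \<Rightarrow> nat) \<Rightarrow> vl" where
  "ren (Val v) r = Val (renv v r)"
| "ren (App t s) r = App (ren t r) (ren s r)"
| "renv (Var n) r = Var (r n)"
| "renv (Lam t) r = Lam (ren t (up_ren r))"

definition up_sub :: "(nat \<Rightarrow> vl) \<Rightarrow> nat \<Rightarrow> vl" where
  "up_sub f = case_nat (Var 0) (\<lambda>n. renv (f n) Suc)"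

primrec sub :: "tm \<Rightarrow> (nat \<Rightarrow> vl) \<Rightarrow> tm" and subv :: "vl \<Rightarrow> (nat \<Rightarrow> vl) \<Rightarrow> vl" where
  "sub (Val v) f = Val (subv v f)"
| "sub (App t s) f = App (sub t f) (sub s f)"
| "subv (Var n) f = f n"
| "subv (Lam t) f = Lam (sub t (up_sub f))"

definition Abs :: "nat \<Rightarrow> tm \<Rightarrow> vl" where
  "Abs x t = Lam (ren t (\<lambda>n. if n = x then 0 else Suc n))"

abbreviation subst1 :: "tm \<Rightarrow> vl \<Rightarrow> nat \<Rightarrow> tm" (\<open>_\<lbrace>_'/_\<rbrace>\<close> [1000, 80, 80] 1000) where
  "t\<lbrace>v/x\<rbrace> \<equiv> sub t (Var(x := v))"

abbreviation subst1v :: "vl \<Rightarrow> vl \<Rightarrow> nat \<Rightarrow> vl" where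
  "subst1v w v x \<equiv> subv w (Var(x := v))"

text \<open>
  The following facts confirm that \<open>Abs\<close> and substitution are the usual operations on terms
  modulo alpha-conversion.
\<close>

lemma ren_cong:
  "(\<And>n. n \<in> fv t \<Longrightarrow> r n = r' n) \<Longrightarrow> ren t r = ren t r'"
  "(\<And>n. n \<in> fvv v \<Longrightarrow> r n = r' n) \<Longrightarrow> renv v r = renv v r'"
proof (induction t and v arbitrary: r r' and r r')
  case (Val v)
  have "renv v r = renv v r'" by (rule Val.IH) (simp add: Val.prems)
  then show ?case by simp
next
  case (App t s)
  have "ren t r = ren t r'" by (rule App.IH(1)) (simp add: App.prems)
  moreover have "ren s r = ren s r'" by (rule App.IH(2)) (simp add: App.prems)
  ultimately show ?case by simp
next
  case (Var n)
  then show ?case by simp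
next
  case (Lam t)
  have "ren t (up_ren r) = ren t (up_ren r')"
    by (rule Lam.IH) (auto simp: up_ren_def Lam.prems split: nat.split)
  then show ?case by simp
qed

lemma sub_cong:
  "(\<And>n. n \<in> fv t \<Longrightarrow> f n = g n) \<Longrightarrow> sub t f = sub t g"
  "(\<And>n. n \<in> fvv v \<Longrightarrow> f n = g n) \<Longrightarrow> subv v f = subv v g"
proof (induction t and v arbitrary: f g and f g)
  case (Val v)
  have "subv v f = subv v g" by (rule Val.IH) (simp add: Val.prems)
  then show ?case by simp
next
  case (App t s)
  have "sub t f = sub t g" by (rule App.IH(1)) (simp add: App.prems)
  moreover have "sub s f = sub s g" by (rule App.IH(2)) (simp add: App.prems)
  ultimately show ?case by simp
next
  case (Var n)
  then show ?case by simp
next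
  case (Lam t)
  have "sub t (up_sub f) = sub t (up_sub g)"
    by (rule Lam.IH) (auto simp: up_sub_def Lam.prems split: nat.split)
  then show ?case by simp
qed

lemma ren_ren:
  "ren (ren t r) r' = ren t (\<lambda>n. r' (r n))"
  "renv (renv v r) r' = renv v (\<lambda>n. r' (r n))"
proof (induction t and v arbitrary: r r' and r r')
  case (Lam t)
  have "(\<lambda>n. up_ren r' (up_ren r n)) = up_ren (\<lambda>n. r' (r n))"
    by (auto simp: up_ren_def fun_eq_iff split: nat.split)
  then show ?case by (simp only: ren.simps renv.simps sub.simps subv.simps Lam.IH)
qed auto

lemma ren_eq_sub:
  "ren t r = sub t (\<lambda>n. Var (r n))"
  "renv v r = subv v (\<lambda>n. Var (r n))"
proof (induction t and v arbitrary: r and r)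
  case (Lam t)
  have "(\<lambda>n. Var (up_ren r n)) = up_sub (\<lambda>n. Var (r n))"
    by (auto simp: up_ren_def up_sub_def fun_eq_iff split: nat.split)
  then show ?case by (simp only: ren.simps renv.simps sub.simps subv.simps Lam.IH)
qed auto

lemma sub_ren:
  "sub (ren t r) f = sub t (\<lambda>n. f (r n))"
  "subv (renv v r) f = subv v (\<lambda>n. f (r n))"
proof (induction t and v arbitrary: r f and r f)
  case (Lam t)
  have "(\<lambda>n. up_sub f (up_ren r n)) = up_sub (\<lambda>n. f (r n))"
    by (auto simp: up_ren_def up_sub_def fun_eq_iff split: nat.split)
  then show ?case by (simp only: ren.simps renv.simps sub.simps subv.simps Lam.IH)
qed auto

lemma ren_sub:
  "ren (sub t f) r = sub t (\<lambda>n. renv (f n) r)"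
  "renv (subv v f) r = subv v (\<lambda>n. renv (f n) r)"
proof (induction t and v arbitrary: r f and r f)
  case (Lam t)
  have "(\<lambda>n. renv (up_sub f n) (up_ren r)) = up_sub (\<lambda>n. renv (f n) r)"
    by (auto simp: up_ren_def up_sub_def fun_eq_iff ren_ren split: nat.split)
  then show ?case by (simp only: ren.simps renv.simps sub.simps subv.simps Lam.IH)
qed auto

lemma ren_id:
  "ren t (\<lambda>n. n) = t"
  "renv v (\<lambda>n. n) = v"
proof (induction t and v)
  case (Lam t)
  have "up_ren (\<lambda>n. n) = (\<lambda>n. n)"
    by (auto simp: up_ren_def fun_eq_iff split: nat.split)
  then show ?case by (simp only: ren.simps renv.simps sub.simps subv.simps Lam.IH)
qed auto

lemma finite_fv: "finite (fv t)" "finite (fvv v)"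
  by (induction t and v) (auto intro: finite_vimageI)

lemma fv_ren: "fv (ren t r) = r ` fv t" "fvv (renv v r) = r ` fvv v"
proof (induction t and v arbitrary: r and r)
  case (Lam t)
  have "Suc n = up_ren r m \<longleftrightarrow> (\<exists>k. m = Suc k \<and> n = r k)" for n m
    by (auto simp: up_ren_def split: nat.split)
  then show ?case unfolding renv.simps fvv.simps Lam.IH by fastforce
qed auto

lemma fvv_Abs: "fvv (Abs x t) = fv t - {x}"
  by (auto simp: Abs_def fv_ren split: if_splits)

lemma Abs_inject: "Abs x t = Abs x s \<longleftrightarrow> t = s"
proof
  assume "Abs x t = Abs x s"
  then have "ren t (\<lambda>n. if n = x then 0 else Suc n) = ren s (\<lambda>n. if n = x then 0 else Suc n)"
    by (simp add: Abs_def)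
  then have "ren (ren t (\<lambda>n. if n = x then 0 else Suc n)) (case_nat x id)
           = ren (ren s (\<lambda>n. if n = x then 0 else Suc n)) (case_nat x id)"
    by simp
  moreover have "(\<lambda>n. case_nat x id (if n = x then 0 else Suc n)) = (\<lambda>n. n)"
    by auto
  ultimately show "t = s" by (simp add: ren_ren ren_id)
qed simp

lemma vl_cases_fresh:
  assumes "finite X"
  obtains y where "v = Var y" | x t where "x \<notin> X" "v = Abs x t"
proof (cases v)
  case (Lam u)
  obtain x where x: "x \<notin> X \<union> fvv v"
    using assms finite_fv ex_new_if_finite[OF infinite_UNIV_nat] by (metis finite_UnI)
  have "ren u (\<lambda>n. if case_nat x id n = x then 0 else Suc (case_nat x id n)) = ren u (\<lambda>n. n)"
    by (rule ren_cong) (use x Lam in \<open>auto split: nat.split\<close>)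
  then have "v = Abs x (ren u (case_nat x id))"
    by (simp add: Lam Abs_def ren_ren ren_id)
  then show thesis using that x by blast
qed (use that in blast)

lemma Abs_alpha:
  assumes "y \<notin> fv t"
  shows "Abs x t = Abs y (t\<lbrace>Var y/x\<rbrace>)"
proof -
  have "ren (t\<lbrace>Var y/x\<rbrace>) (\<lambda>n. if n = y then 0 else Suc n)
      = sub t (\<lambda>n. Var (if n = x then 0 else Suc n))"
    unfolding ren_sub by (rule sub_cong) (use assms in auto)
  then show ?thesis by (simp add: Abs_def ren_eq_sub(1)[of t])
qed

lemma subst1v_Abs:
  assumes "y \<noteq> x" "y \<notin> fvv v"
  shows "subst1v (Abs y t) v x = Abs y (t\<lbrace>v/x\<rbrace>)"
proof -
  have v: "renv v (\<lambda>n. if n = y then 0 else Suc n) = renv v Suc"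
    by (rule ren_cong) (use assms in auto)
  show ?thesis unfolding Abs_def
    by (auto simp: sub_ren ren_sub v up_sub_def assms intro!: sub_cong)
qed

section \<open>Call-by-value reduction\<close>

datatype evctx = Hole | CtxL evctx tm | CtxR vl evctx

primrec plug :: "evctx \<Rightarrow> tm \<Rightarrow> tm" where
  "plug Hole s = s"
| "plug (CtxL E t) s = App (plug E s) t"
| "plug (CtxR v E) s = App (Val v) (plug E s)"

primrec fvc :: "evctx \<Rightarrow> nat set" where
  "fvc Hole = {}"
| "fvc (CtxL E t) = fvc E \<union> fv t"
| "fvc (CtxR v E) = fvv v \<union> fvc E"

inductive step :: "tm \<Rightarrow> tm \<Rightarrow> bool" (infix \<open>\<rightarrow>\<^sub>v\<close> 50) where
  "plug E (App (Val (Abs x t)) (Val v)) \<rightarrow>\<^sub>v plug E (t\<lbrace>v/x\<rbrace>)"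

abbreviation steps :: "tm \<Rightarrow> tm \<Rightarrow> bool" (infix \<open>\<rightarrow>\<^sub>v\<^sup>*\<close> 50) where
  "t \<rightarrow>\<^sub>v\<^sup>* s \<equiv> step\<^sup>*\<^sup>* t s"

definition evaluates :: "tm \<Rightarrow> tm \<Rightarrow> bool" (infix \<open>\<Down>\<close> 50) where
  "t \<Down> s \<longleftrightarrow> t \<rightarrow>\<^sub>v\<^sup>* s \<and> (\<nexists>u. s \<rightarrow>\<^sub>v u)"

section \<open>Diacritical progress\<close>

text \<open>
  The relations are arbitrary, not necessarily closed under renaming. ``For a fresh \<open>x\<close>'' is read
  as ``for some fresh \<open>x\<close>''; with ``for all'' the functions \<open>up_subst\<close> and \<open>up_ectx\<close> below
  would not be continuous.
\<close>

type_synonym trel = "(tm \<times> tm) set"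

definition rel_v :: "trel \<Rightarrow> (vl \<times> vl) set" where
  "rel_v R = {(v, w). \<exists>x. x \<notin> fvv v \<union> fvv w \<and>
      (App (Val v) (Val (Var x)), App (Val w) (Val (Var x))) \<in> R}"

definition rel_c :: "trel \<Rightarrow> (evctx \<times> evctx) set" where
  "rel_c R = {(E, E'). \<exists>x. x \<notin> fvc E \<union> fvc E' \<and>
      (plug E (Val (Var x)), plug E' (Val (Var x))) \<in> R}"

definition open_stuck :: "evctx \<Rightarrow> nat \<Rightarrow> vl \<Rightarrow> tm" where
  "open_stuck E x v = plug E (App (Val (Var x)) (Val v))"

definition rel_o :: "trel \<Rightarrow> trel" where
  "rel_o R = {(open_stuck E x v, open_stuck E' x w) | E E' x v w.
      (E, E') \<in> rel_c R \<and> (v, w) \<in> rel_v R}"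

definition progress :: "trel \<Rightarrow> trel \<Rightarrow> trel \<Rightarrow> bool" where
  "progress R S T \<longleftrightarrow> R \<subseteq> S \<and> S \<subseteq> T \<and>
    (\<forall>t s. (t, s) \<in> R \<longrightarrow>
      (\<forall>t'. t \<rightarrow>\<^sub>v t' \<longrightarrow> (\<exists>s'. s \<rightarrow>\<^sub>v\<^sup>* s' \<and> (t', s') \<in> T)) \<and>
      (\<forall>v. t = Val v \<longrightarrow> (\<exists>w. s \<Down> Val w \<and> (v, w) \<in> rel_v S)) \<and>
      (\<forall>E x v. t = open_stuck E x v \<longrightarrow>
        (\<exists>E' w. s \<Down> open_stuck E' x w \<and> (open_stuck E x v, open_stuck E' x w) \<in> rel_o T)) \<and>
      (\<forall>s'. s \<rightarrow>\<^sub>v s' \<longrightarrow> (\<exists>t'. t \<rightarrow>\<^sub>v\<^sup>* t' \<and> (t', s') \<in> T)) \<and>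
      (\<forall>w. s = Val w \<longrightarrow> (\<exists>v. t \<Down> Val v \<and> (v, w) \<in> rel_v S)) \<and>
      (\<forall>E' x w. s = open_stuck E' x w \<longrightarrow>
        (\<exists>E v. t \<Down> open_stuck E x v \<and> (open_stuck E x v, open_stuck E' x w) \<in> rel_o T)))"

section \<open>Diacritical compatibility\<close>

type_synonym rfun = "trel \<Rightarrow> trel"

definition fun_of :: "rfun set \<Rightarrow> rfun" where
  "fun_of G = (\<lambda>R. \<Union>f\<in>G. f R)"

definition hat :: "rfun \<Rightarrow> rfun" where
  "hat f = (\<lambda>R. f R \<union> id R)"

definition omega :: "rfun \<Rightarrow> rfun" where
  "omega f = (\<lambda>R. \<Union>n. (f ^^ n) R)"

definition continuous_fun :: "rfun \<Rightarrow> bool" where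
  "continuous_fun f \<longleftrightarrow> (\<forall>R. f R \<subseteq> \<Union>{f S | S. S \<subseteq> R \<and> finite S})"

definition evolves :: "rfun \<Rightarrow> rfun \<Rightarrow> rfun \<Rightarrow> bool" where
  "evolves f g h \<longleftrightarrow> (\<forall>R T. progress R R T \<longrightarrow> progress (f R) (g R) (h T))"

definition strongly_evolves :: "rfun \<Rightarrow> rfun \<Rightarrow> rfun \<Rightarrow> bool" where
  "strongly_evolves f g h \<longleftrightarrow> (\<forall>R S T. progress R S T \<longrightarrow> progress (f R) (g S) (h T))"

definition strong_subset :: "rfun set \<Rightarrow> rfun set \<Rightarrow> bool" where
  "strong_subset F S \<longleftrightarrow> S \<subseteq> F \<and>
    (\<forall>f\<in>S. strongly_evolves f (omega (hat (fun_of S))) (omega (hat (fun_of F)))) \<and>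
    (\<forall>f\<in>F. evolves f
      (omega (hat (fun_of S)) \<circ> hat (fun_of F) \<circ> omega (hat (fun_of S)))
      (omega (hat (fun_of F))))"

definition diacritically_compatible :: "rfun set \<Rightarrow> bool" where
  "diacritically_compatible F \<longleftrightarrow> (\<forall>f\<in>F. continuous_fun f) \<and> (\<exists>S. strong_subset F S)"

definition strong :: "rfun set \<Rightarrow> rfun set" where
  "strong F = \<Union>{S. strong_subset F S}"

section \<open>The up-to functions\<close>

definition up_refl :: rfun where
  "up_refl R = {(t, t) | t. True}"

definition up_lam :: rfun where
  "up_lam R = {(Val (Abs x t), Val (Abs x s)) | x t s. (t, s) \<in> R}"

definition up_subst :: rfun where
  "up_subst R = {(t\<lbrace>v/x\<rbrace>, s\<lbrace>w/x\<rbrace>) | t s v w x. (t, s) \<in> R \<and> (v, w) \<in> rel_v R}"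

definition up_ectx :: rfun where
  "up_ectx R = {(plug E t, plug E' s) | E E' t s. (t, s) \<in> R \<and> (E, E') \<in> rel_c R}"

definition up_red :: rfun where
  "up_red R = {(t, s) | t s. \<exists>t' s'. t \<rightarrow>\<^sub>v\<^sup>* t' \<and> s \<rightarrow>\<^sub>v\<^sup>* s' \<and> (t', s') \<in> R}"

end

theory Submission
  imports Defs
begin

text \<open>
  Progress is a simulation game played by a relation and by its converse, and all the functions
  commute with converse, so one direction suffices. The crucial case is \<open>up_subst\<close>: when the
  substituted variable \<open>x\<close> is the head of a stuck term \<open>E[x u]\<close>, the answer is obtained by
  playing the game on \<open>(v z, w z)\<close> for the substituted values \<open>v, w\<close> and a fresh \<open>z\<close>, and the
  result is put back in context with \<open>up_ectx\<close>. This is allowed because only the clause for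
  values (the passive one) is restricted to the strong functions. A pair \<open>(E[t], E'[s])\<close> in which
  \<open>t\<close> is a value reduces to the case of \<open>up_subst\<close>, but only if the values reached are related
  by the relation under test itself, that is, if \<open>S = R\<close>. The relation \<open>Id \<union> {(y, z)}\<close> for
  distinct variables \<open>y, z\<close> progresses to the full relation and shows that \<open>up_ectx\<close> does not
  strongly evolve to anything.
\<close>

section \<open>Substitution and evaluation contexts\<close>

lemma sub_sub:
  "sub (sub t f) g = sub t (\<lambda>n. subv (f n) g)"
  "subv (subv v f) g = subv v (\<lambda>n. subv (f n) g)"
proof (induction t and v arbitrary: f g and f g)
  case (Lam t)
  have "(\<lambda>n. subv (up_sub f n) (up_sub g)) = up_sub (\<lambda>n. subv (f n) g)"
    by (auto simp: up_sub_def fun_eq_iff sub_ren ren_sub split: nat.split)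
  then show ?case by (simp only: sub.simps subv.simps Lam.IH)
qed auto

lemma sub_Var [simp]: "sub t Var = t" "subv v Var = v"
  using ren_id ren_eq_sub[of _ "\<lambda>n. n"] by simp_all

lemma sub_fresh [simp]:
  "x \<notin> fv t \<Longrightarrow> t\<lbrace>v/x\<rbrace> = t"
  "x \<notin> fvv w \<Longrightarrow> subst1v w v x = w"
  using sub_cong(1)[of t "Var(x := v)" Var] sub_cong(2)[of w "Var(x := v)" Var]
  by (metis fun_upd_other sub_Var(1), metis fun_upd_other sub_Var(2))

text \<open>The hole of an evaluation context lies under no binder, so substitution acts
  componentwise with no shifting.\<close>

primrec subc :: "evctx \<Rightarrow> (nat \<Rightarrow> vl) \<Rightarrow> evctx" where
  "subc Hole f = Hole"
| "subc (CtxL E t) f = CtxL (subc E f) (sub t f)"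
| "subc (CtxR v E) f = CtxR (subv v f) (subc E f)"

primrec compc :: "evctx \<Rightarrow> evctx \<Rightarrow> evctx" where
  "compc Hole F = F"
| "compc (CtxL E t) F = CtxL (compc E F) t"
| "compc (CtxR v E) F = CtxR v (compc E F)"

lemma plug_compc: "plug (compc E F) t = plug E (plug F t)"
  by (induction E) auto

lemma sub_plug: "sub (plug E t) f = plug (subc E f) (sub t f)"
  by (induction E) auto

lemma subc_fresh [simp]: "x \<notin> fvc E \<Longrightarrow> subc E (Var(x := v)) = E"
  by (induction E) auto

lemma finite_fvc [simp]: "finite (fvc E)"
  by (induction E) (auto simp: finite_fv)

lemma plug_eq_Val [simp]: "plug E (App t s) \<noteq> Val v" "Val v \<noteq> plug E (App t s)"
  by (cases E; simp)+

text \<open>Unique decomposition: a plugged application is never a value, and this fixes, from left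
  to right, where the hole sits. Both contexts must therefore branch alike.\<close>

lemma plug_App_inject:
  "plug E (App (Val v) (Val w)) = plug E' (App (Val v') (Val w')) \<Longrightarrow> E = E' \<and> v = v' \<and> w = w'"
proof (induction E arbitrary: E')
  case Hole
  then show ?case by (cases E') auto
next
  case (CtxL E t)
  then show ?case by (cases E') auto
next
  case (CtxR u E)
  then show ?case by (cases E') auto
qed

lemma tm_cases_plug:
  obtains v where "t = Val v" | E v w where "t = plug E (App (Val v) (Val w))"
proof -
  have "(\<exists>v. t = Val v) \<or> (\<exists>E v w. t = plug E (App (Val v) (Val w)))"
  proof (induction t rule: measure_induct_rule[of size])
    case (less r)
    show ?case
    proof (cases r)
      case (App t s)
      then consider (redex) v w where "t = Val v" "s = Val w"
        | (left) E v w where "t = plug E (App (Val v) (Val w))"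
        | (right) u E v w where "t = Val u" "s = plug E (App (Val v) (Val w))"
        using less[of t] less[of s] by auto
      then show ?thesis
      proof cases
        case redex
        then have "r = plug Hole (App (Val v) (Val w))" using App by simp
        then show ?thesis by blast
      next
        case left
        then have "r = plug (CtxL E s) (App (Val v) (Val w))" using App by simp
        then show ?thesis by blast
      next
        case right
        then have "r = plug (CtxR u E) (App (Val v) (Val w))" using App by simp
        then show ?thesis by blast
      qed
    qed auto
  qed
  then show thesis using that by blast
qed

section \<open>Reduction\<close>

text \<open>Bridge from named substitution to filling index 0 of a de Bruijn body. It makes
  contraction independent of the chosen bound name.\<close>

lemma Abs_beta: "t\<lbrace>v/x\<rbrace> = sub (ren t (\<lambda>n. if n = x then 0 else Suc n)) (case_nat v Var)"
  unfolding sub_ren by (rule sub_cong) auto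

lemma step_beta: "plug E (App (Val (Lam u)) (Val v)) \<rightarrow>\<^sub>v plug E (sub u (case_nat v Var))"
proof -
  obtain x t where "Lam u = Abs x t"
    using vl_cases_fresh[of "{}" "Lam u"] by auto
  then show ?thesis
    using step.intros[of E x t v] Abs_beta[of t x v] by (simp add: Abs_def)
qed

lemma step_elim:
  assumes "t \<rightarrow>\<^sub>v t'"
  obtains E u v where
    "t = plug E (App (Val (Lam u)) (Val v))" "t' = plug E (sub u (case_nat v Var))"
  using assms by cases (simp add: Abs_def Abs_beta)

lemma step_sub:
  assumes "t \<rightarrow>\<^sub>v t'"
  shows "sub t f \<rightarrow>\<^sub>v sub t' f"
proof -
  obtain E u v where
    t: "t = plug E (App (Val (Lam u)) (Val v))" and t': "t' = plug E (sub u (case_nat v Var))"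
    using assms by (rule step_elim)
  \<comment> \<open>Contraction commutes with substitution: both sides send index 0 to
    \<open>subv v f\<close>, and at \<open>Suc n\<close> the shift that \<open>up_sub\<close>
    applies to \<open>f n\<close> is undone by \<open>case_nat\<close>.\<close>
  have "(\<lambda>n. subv (case_nat v Var n) f)
      = (\<lambda>n. subv (up_sub f n) (case_nat (subv v f) Var))"
    by (auto simp: fun_eq_iff up_sub_def sub_ren split: nat.split)
  then have "sub (sub u (case_nat v Var)) f
      = sub (sub u (up_sub f)) (case_nat (subv v f) Var)"
    by (simp add: sub_sub)
  then show ?thesis
    using step_beta[of "subc E f" "sub u (up_sub f)" "subv v f"] by (simp add: t t' sub_plug)
qed

lemma step_plug: "t \<rightarrow>\<^sub>v t' \<Longrightarrow> plug E t \<rightarrow>\<^sub>v plug E t'"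
  by (metis plug_compc step_beta step_elim)

lemma steps_sub: "t \<rightarrow>\<^sub>v\<^sup>* t' \<Longrightarrow> sub t f \<rightarrow>\<^sub>v\<^sup>* sub t' f"
  by (induction rule: rtranclp_induct) (auto intro: step_sub rtranclp.rtrancl_into_rtrancl)

lemma steps_plug: "t \<rightarrow>\<^sub>v\<^sup>* t' \<Longrightarrow> plug E t \<rightarrow>\<^sub>v\<^sup>* plug E t'"
  by (induction rule: rtranclp_induct) (auto intro: step_plug rtranclp.rtrancl_into_rtrancl)

lemma step_deterministic:
  assumes "t \<rightarrow>\<^sub>v t'" "t \<rightarrow>\<^sub>v t''"
  shows "t' = t''"
  using assms by (elim step_elim) (auto dest: plug_App_inject)

lemma Val_irreducible [simp]: "\<not> Val v \<rightarrow>\<^sub>v t"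
  by (auto elim: step_elim)

lemma open_stuck_irreducible [simp]: "\<not> open_stuck E x v \<rightarrow>\<^sub>v t"
  unfolding open_stuck_def by (auto elim!: step_elim dest: plug_App_inject)

lemma open_stuck_inject [simp]:
  "open_stuck E x v = open_stuck E' x' v' \<longleftrightarrow> E = E' \<and> x = x' \<and> v = v'"
  unfolding open_stuck_def by (auto dest: plug_App_inject)

lemma open_stuck_neq_Val [simp]: "open_stuck E x v \<noteq> Val w" "Val w \<noteq> open_stuck E x v"
  by (simp_all add: open_stuck_def)

text \<open>In a decomposition the applied value is either an abstraction, which gives a step, or a
  variable, which gives a stuck term.\<close>

lemma tm_trichotomy:
  obtains v where "t = Val v" | E x v where "t = open_stuck E x v" | t' where "t \<rightarrow>\<^sub>v t'"
proof (cases t rule: tm_cases_plug)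
  case (2 E v w)
  then show ?thesis
    using that(2)[of E _ w] that(3) step_beta[of E _ w] by (cases v) (auto simp: open_stuck_def)
qed (use that in blast)

lemma evaluates_Val: "t \<Down> Val v \<longleftrightarrow> t \<rightarrow>\<^sub>v\<^sup>* Val v"
  by (simp add: evaluates_def)

lemma evaluates_open_stuck: "t \<Down> open_stuck E x v \<longleftrightarrow> t \<rightarrow>\<^sub>v\<^sup>* open_stuck E x v"
  by (simp add: evaluates_def)

section \<open>Progress as a two-sided simulation\<close>

text \<open>The half of the game in which \<open>t\<close> moves. Only the clause for values
  mentions \<open>S\<close>. Each rule carries its witnesses, so case analysis yields the answer of
  \<open>s\<close> directly.\<close>

inductive sim :: "trel \<Rightarrow> trel \<Rightarrow> tm \<Rightarrow> tm \<Rightarrow> bool" for S T where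
  sim_step: "t \<rightarrow>\<^sub>v t' \<Longrightarrow> s \<rightarrow>\<^sub>v\<^sup>* s' \<Longrightarrow> (t', s') \<in> T \<Longrightarrow> sim S T t s"
| sim_Val: "s \<rightarrow>\<^sub>v\<^sup>* Val w \<Longrightarrow> (v, w) \<in> rel_v S \<Longrightarrow> sim S T (Val v) s"
| sim_stuck: "s \<rightarrow>\<^sub>v\<^sup>* open_stuck E' x w \<Longrightarrow> (E, E') \<in> rel_c T \<Longrightarrow> (v, w) \<in> rel_v T
    \<Longrightarrow> sim S T (open_stuck E x v) s"

lemma rel_o_iff:
  "(open_stuck E x v, open_stuck E' x w) \<in> rel_o T \<longleftrightarrow> (E, E') \<in> rel_c T \<and> (v, w) \<in> rel_v T"
  by (auto simp: rel_o_def)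

text \<open>The three shapes of \<open>t\<close> exclude each other and its reduct is unique, so one
  rule settles all three implications. Values and stuck terms are irreducible, so evaluating to them
  is the same as reducing to them.\<close>

lemma sim_iff:
  "sim S T t s \<longleftrightarrow>
    (\<forall>t'. t \<rightarrow>\<^sub>v t' \<longrightarrow> (\<exists>s'. s \<rightarrow>\<^sub>v\<^sup>* s' \<and> (t', s') \<in> T)) \<and>
    (\<forall>v. t = Val v \<longrightarrow> (\<exists>w. s \<Down> Val w \<and> (v, w) \<in> rel_v S)) \<and>
    (\<forall>E x v. t = open_stuck E x v \<longrightarrow>
      (\<exists>E' w. s \<Down> open_stuck E' x w \<and> (open_stuck E x v, open_stuck E' x w) \<in> rel_o T))"
  (is "_ \<longleftrightarrow> ?R")
proof
  assume "sim S T t s"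
  then show ?R
    by cases
      (auto simp: evaluates_Val evaluates_open_stuck rel_o_iff dest: step_deterministic)
next
  assume ?R
  then show "sim S T t s"
    by (cases t rule: tm_trichotomy)
      (auto simp: evaluates_Val evaluates_open_stuck rel_o_iff intro: sim.intros)
qed

lemma rel_v_mono: "R \<subseteq> S \<Longrightarrow> rel_v R \<subseteq> rel_v S"
  unfolding rel_v_def by blast

lemma rel_c_mono: "R \<subseteq> S \<Longrightarrow> rel_c R \<subseteq> rel_c S"
  unfolding rel_c_def by blast

lemma rel_v_converse: "rel_v (R\<inverse>) = (rel_v R)\<inverse>"
  unfolding rel_v_def by auto

lemma rel_c_converse: "rel_c (R\<inverse>) = (rel_c R)\<inverse>"
  unfolding rel_c_def by auto

lemma rel_o_converse: "rel_o (R\<inverse>) = (rel_o R)\<inverse>"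
  unfolding rel_o_def rel_v_converse rel_c_converse by auto

lemma sim_mono:
  assumes "sim S T t s" "S \<subseteq> S'" "T \<subseteq> T'"
  shows "sim S' T' t s"
  using assms(1) rel_v_mono[OF assms(2)] rel_v_mono[OF assms(3)] rel_c_mono[OF assms(3)] assms(3)
  by cases (auto intro: sim.intros)

lemma sim_antireduce: "s \<rightarrow>\<^sub>v\<^sup>* s' \<Longrightarrow> sim S T t s' \<Longrightarrow> sim S T t s"
  by (erule sim.cases) (auto intro: sim.intros rtranclp_trans)

definition simulates :: "trel \<Rightarrow> trel \<Rightarrow> trel \<Rightarrow> bool" where
  "simulates R S T \<longleftrightarrow> (\<forall>(t, s)\<in>R. sim S T t s)"

lemma simulatesD: "simulates R S T \<Longrightarrow> (t, s) \<in> R \<Longrightarrow> sim S T t s"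
  by (auto simp: simulates_def)

lemma progress_iff:
  "progress R S T \<longleftrightarrow>
    R \<subseteq> S \<and> S \<subseteq> T \<and> simulates R S T \<and> simulates (R\<inverse>) (S\<inverse>) (T\<inverse>)"
proof -
  have conv: "simulates (R\<inverse>) (S\<inverse>) (T\<inverse>) \<longleftrightarrow> (\<forall>t s. (t, s) \<in> R \<longrightarrow> sim (S\<inverse>) (T\<inverse>) s t)"
    by (auto simp: simulates_def)
  show ?thesis
    unfolding conv
    unfolding progress_def simulates_def sim_iff rel_v_converse rel_o_converse converse_iff
    by fast
qed

lemma progress_mono:
  assumes "progress R S T" "S \<subseteq> S'" "T \<subseteq> T'" "S' \<subseteq> T'"
  shows "progress R S' T'"
  using assms sim_mono[OF _ assms(2,3)]
    sim_mono[OF _ assms(2,3)[folded converse_mono[of S S'] converse_mono[of T T']]]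
  unfolding progress_iff simulates_def by blast

section \<open>Relations closed under the up-to functions\<close>

text \<open>Closure under \<open>up_subst\<close> lets related arguments replace the fresh name in a
  test of \<open>rel_v\<close> or \<open>rel_c\<close>; \<open>up_refl\<close> relates every
  variable to itself, which allows a change of that name.\<close>

definition subst_closed :: "trel \<Rightarrow> bool" where
  "subst_closed R \<longleftrightarrow> up_refl R \<subseteq> R \<and> up_subst R \<subseteq> R"

lemma up_reflI: "up_refl R \<subseteq> R \<Longrightarrow> (t, t) \<in> R"
  by (auto simp: up_refl_def)

lemma up_substI:
  "up_subst R \<subseteq> R \<Longrightarrow> (t, s) \<in> R \<Longrightarrow> (v, w) \<in> rel_v R \<Longrightarrow> (t\<lbrace>v/x\<rbrace>, s\<lbrace>w/x\<rbrace>) \<in> R"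
  unfolding up_subst_def by blast

lemma up_ectxI:
  "up_ectx R \<subseteq> R \<Longrightarrow> (t, s) \<in> R \<Longrightarrow> (E, E') \<in> rel_c R \<Longrightarrow> (plug E t, plug E' s) \<in> R"
  unfolding up_ectx_def by blast

lemma fresh_name:
  assumes "finite X"
  obtains z :: nat where "z \<notin> X"
  using assms ex_new_if_finite[OF infinite_UNIV_nat] by blast

section \<open>Related values and contexts in substitution-closed relations\<close>

lemma rel_v_refl:
  assumes "up_refl R \<subseteq> R"
  shows "(v, v) \<in> rel_v R"
proof -
  obtain z where "z \<notin> fvv v" using fresh_name finite_fv(2) by blast
  then show ?thesis using up_reflI[OF assms] by (auto simp: rel_v_def)
qed

lemma rel_c_refl:
  assumes "up_refl R \<subseteq> R"
  shows "(E, E) \<in> rel_c R"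
proof -
  obtain z where "z \<notin> fvc E" using fresh_name finite_fvc by blast
  then show ?thesis using up_reflI[OF assms] by (auto simp: rel_c_def)
qed

text \<open>The test name \<open>x\<close> is fresh for \<open>v\<close> and \<open>w\<close>, so
  substituting \<open>u\<close> and \<open>u'\<close> for it changes the argument only. A test at
  one fresh name thus covers all related arguments.\<close>

lemma rel_v_App:
  assumes "up_subst R \<subseteq> R" "(v, w) \<in> rel_v R" "(u, u') \<in> rel_v R"
  shows "(App (Val v) (Val u), App (Val w) (Val u')) \<in> R"
proof -
  obtain x where x: "x \<notin> fvv v" "x \<notin> fvv w"
    "(App (Val v) (Val (Var x)), App (Val w) (Val (Var x))) \<in> R"
    using assms(2) by (auto simp: rel_v_def)
  show ?thesis using up_substI[OF assms(1) x(3) assms(3), of x] x(1,2) by simp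
qed

lemma rel_c_plug:
  assumes "up_subst R \<subseteq> R" "(E, E') \<in> rel_c R" "(u, u') \<in> rel_v R"
  shows "(plug E (Val u), plug E' (Val u')) \<in> R"
proof -
  obtain x where x: "x \<notin> fvc E" "x \<notin> fvc E'"
    "(plug E (Val (Var x)), plug E' (Val (Var x))) \<in> R"
    using assms(2) by (auto simp: rel_c_def)
  show ?thesis using up_substI[OF assms(1) x(3) assms(3), of x] x(1,2) by (simp add: sub_plug)
qed

lemma rel_v_subst:
  assumes "subst_closed R" "(u, u') \<in> rel_v R" "(v, w) \<in> rel_v R"
  shows "(subst1v u v x, subst1v u' w x) \<in> rel_v R"
proof -
  \<comment> \<open>\<open>z\<close> differs from \<open>x\<close>, so the substitution leaves the
    test argument alone, and it is fresh for the results, so it witnesses \<open>rel_v\<close> for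
    them. The given test name need not have these properties.\<close>
  obtain z where z: "z \<notin> insert x (fvv (subst1v u v x) \<union> fvv (subst1v u' w x))"
    by (rule fresh_name[rotated], erule that) (simp_all add: finite_fv)
  have "(App (Val u) (Val (Var z)), App (Val u') (Val (Var z))) \<in> R"
    using assms(1,2) rel_v_App rel_v_refl by (auto simp: subst_closed_def)
  then have "((App (Val u) (Val (Var z)))\<lbrace>v/x\<rbrace>, (App (Val u') (Val (Var z)))\<lbrace>w/x\<rbrace>) \<in> R"
    using assms(1,3) up_substI unfolding subst_closed_def by blast
  then show ?thesis using z by (auto simp: rel_v_def)
qed

lemma rel_c_subst:
  assumes "subst_closed R" "(E, E') \<in> rel_c R" "(v, w) \<in> rel_v R"
  shows "(subc E (Var(x := v)), subc E' (Var(x := w))) \<in> rel_c R"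
proof -
  obtain z where
    z: "z \<notin> insert x (fvc (subc E (Var(x := v))) \<union> fvc (subc E' (Var(x := w))))"
    by (rule fresh_name[rotated], erule that) simp_all
  have "(plug E (Val (Var z)), plug E' (Val (Var z))) \<in> R"
    using assms(1,2) rel_c_plug rel_v_refl by (auto simp: subst_closed_def)
  then have "((plug E (Val (Var z)))\<lbrace>v/x\<rbrace>, (plug E' (Val (Var z)))\<lbrace>w/x\<rbrace>) \<in> R"
    using assms(1,3) up_substI unfolding subst_closed_def by blast
  then show ?thesis using z by (auto simp: rel_c_def sub_plug)
qed

lemma rel_c_compc:
  assumes "subst_closed R" "up_ectx R \<subseteq> R" "(E, E') \<in> rel_c R" "(F, F') \<in> rel_c R"
  shows "(compc E F, compc E' F') \<in> rel_c R"
proof -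
  obtain z where z: "z \<notin> fvc (compc E F) \<union> fvc (compc E' F')"
    by (rule fresh_name[rotated], erule that) simp_all
  have "(plug F (Val (Var z)), plug F' (Val (Var z))) \<in> R"
    using assms(1,4) rel_c_plug rel_v_refl by (auto simp: subst_closed_def)
  then have "(plug (compc E F) (Val (Var z)), plug (compc E' F') (Val (Var z))) \<in> R"
    unfolding plug_compc using assms(2,3) up_ectxI by blast
  then show ?thesis using z by (auto simp: rel_c_def)
qed

section \<open>One-sided evolution\<close>

text \<open>Reduction is stable under substitution of values, and a value or a term stuck on a
  variable other than \<open>x\<close> keeps its shape. The answer of \<open>s\<close> can therefore
  be substituted as well.\<close>

lemma sim_subst:
  assumes "sim S T t s" "\<And>E u. t \<noteq> open_stuck E x u"
    and S': "S \<subseteq> S'" "subst_closed S'" "(v, w) \<in> rel_v S'"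
    and T': "T \<subseteq> T'" "subst_closed T'" "(v, w) \<in> rel_v T'"
  shows "sim S' T' (t\<lbrace>v/x\<rbrace>) (s\<lbrace>w/x\<rbrace>)"
  using assms(1)
proof cases
  case (sim_step t' s')
  moreover have "(t'\<lbrace>v/x\<rbrace>, s'\<lbrace>w/x\<rbrace>) \<in> T'"
    using up_substI[of T' t' s' v w] T' \<open>(t', s') \<in> T\<close> by (auto simp: subst_closed_def)
  ultimately show ?thesis by (blast intro: sim.sim_step step_sub steps_sub)
next
  case (sim_Val w0 v0)
  then have "(subst1v v0 v x, subst1v w0 w x) \<in> rel_v S'"
    using rel_v_subst[OF S'(2) _ S'(3)] rel_v_mono[OF S'(1)] by blast
  moreover have "s\<lbrace>w/x\<rbrace> \<rightarrow>\<^sub>v\<^sup>* Val (subst1v w0 w x)"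
    using steps_sub[OF sim_Val(2)] by simp
  ultimately show ?thesis using sim_Val(1) by (simp add: sim.sim_Val)
next
  case (sim_stuck E' y u' E u)
  then have "y \<noteq> x" using assms(2) by blast
  then have *: "(open_stuck F y r)\<lbrace>q/x\<rbrace> = open_stuck (subc F (Var(x := q))) y (subst1v r q x)"
    for F r q by (simp add: open_stuck_def sub_plug)
  have "(E, E') \<in> rel_c T'" "(u, u') \<in> rel_v T'"
    using sim_stuck(3,4) rel_c_mono[OF T'(1)] rel_v_mono[OF T'(1)] by blast+
  then have "(subc E (Var(x := v)), subc E' (Var(x := w))) \<in> rel_c T'"
    "(subst1v u v x, subst1v u' w x) \<in> rel_v T'"
    using rel_c_subst[OF T'(2) _ T'(3)] rel_v_subst[OF T'(2) _ T'(3)] by blast+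
  moreover have "s\<lbrace>w/x\<rbrace> \<rightarrow>\<^sub>v\<^sup>* open_stuck (subc E' (Var(x := w))) y (subst1v u' w x)"
    using steps_sub[OF sim_stuck(2), of "Var(x := w)"] unfolding * .
  ultimately show ?thesis unfolding sim_stuck(1) * by (simp add: sim.sim_stuck)
qed

text \<open>A term that is not a value makes its own move inside any evaluation context. The plugged
  term is no value either, so the clause for values never fires and \<open>S'\<close> is
  free.\<close>

lemma sim_plug:
  assumes "sim S T t s" "\<And>v. t \<noteq> Val v"
    and T': "T \<subseteq> T'" "subst_closed T'" "up_ectx T' \<subseteq> T'" and E: "(E, E') \<in> rel_c T'"
  shows "sim S' T' (plug E t) (plug E' s)"
  using assms(1)
proof cases
  case (sim_step t' s')
  moreover have "(plug E t', plug E' s') \<in> T'"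
    using up_ectxI[OF T'(3) _ E] T'(1) \<open>(t', s') \<in> T\<close> by blast
  ultimately show ?thesis by (blast intro: sim.sim_step step_plug steps_plug)
next
  case (sim_Val w0 v0)
  then show ?thesis using assms(2) by blast
next
  case (sim_stuck F' y u' F u)
  have "(F, F') \<in> rel_c T'" "(u, u') \<in> rel_v T'"
    using sim_stuck(3,4) rel_c_mono[OF T'(1)] rel_v_mono[OF T'(1)] by blast+
  moreover have "(compc E F, compc E' F') \<in> rel_c T'"
    using rel_c_compc[OF T'(2,3) E] calculation(1) by blast
  moreover have "plug G (open_stuck H y r) = open_stuck (compc G H) y r" for G H r
    by (simp add: open_stuck_def plug_compc)
  ultimately show ?thesis using steps_plug[OF sim_stuck(2), of E'] sim_stuck(1)
    by (simp add: sim.sim_stuck)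
qed

lemma simulates_refl:
  assumes "up_refl S' \<subseteq> S'" "up_refl T' \<subseteq> T'"
  shows "simulates (up_refl R) S' T'"
proof -
  have "sim S' T' t t" for t
    by (cases t rule: tm_trichotomy)
      (use assms in \<open>blast intro: sim.intros rel_v_refl rel_c_refl up_reflI\<close>)+
  then show ?thesis by (auto simp: simulates_def up_refl_def)
qed

text \<open>The bound name \<open>x\<close> is itself fresh for both abstractions. Testing them on
  it gives redexes that reduce to the bodies \<open>t\<close> and \<open>s\<close>, which are
  related by \<open>R\<close>.\<close>

lemma simulates_lam:
  assumes "R \<subseteq> S'" "up_red S' \<subseteq> S'"
  shows "simulates (up_lam R) S' T'"
proof -
  have "sim S' T' (Val (Abs x t)) (Val (Abs x s))" if "(t, s) \<in> R" for x t s
  proof (rule sim_Val)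
    have beta: "App (Val (Abs x r)) (Val (Var x)) \<rightarrow>\<^sub>v\<^sup>* r" for r
      using step.intros[of Hole x r "Var x"] by (simp add: r_into_rtranclp)
    have "(App (Val (Abs x t)) (Val (Var x)), App (Val (Abs x s)) (Val (Var x))) \<in> up_red S'"
      using beta[of t] beta[of s] that assms(1) unfolding up_red_def by blast
    then show "(Abs x t, Abs x s) \<in> rel_v S'"
      using assms(2) by (auto simp: rel_v_def fvv_Abs)
  qed simp
  then show ?thesis by (auto simp: simulates_def up_lam_def)
qed

text \<open>If \<open>t\<close> is already \<open>t'\<close>, the game on \<open>(t', s')\<close>
  answers after \<open>s\<close> has reduced to \<open>s'\<close>. Otherwise the first step of
  \<open>t\<close> is answered by not moving \<open>s\<close>, and the new pair is still related up
  to reduction.\<close>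

lemma simulates_red:
  assumes "simulates R S T" "S \<subseteq> S'" "T \<subseteq> T'" "R \<subseteq> T'" "up_red T' \<subseteq> T'"
  shows "simulates (up_red R) S' T'"
proof -
  have "sim S' T' t s" if t: "t \<rightarrow>\<^sub>v\<^sup>* t'" and s: "s \<rightarrow>\<^sub>v\<^sup>* s'" and R: "(t', s') \<in> R"
    for t t' s s'
    using t
  proof (cases rule: converse_rtranclpE)
    case base
    then show ?thesis
      using simulatesD[OF assms(1) R] sim_mono[OF _ assms(2,3)] sim_antireduce[OF s] by blast
  next
    case (step t'')
    have "(t'', s) \<in> up_red T'"
      using step(2) s R assms(4) unfolding up_red_def by blast
    then show ?thesis using step(1) assms(5) by (blast intro: sim_step)
  qed
  then show ?thesis by (auto simp: simulates_def up_red_def)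
qed

text \<open>Since \<open>v\<close> and \<open>w\<close> are related through \<open>R\<close> itself,
  the game can be played on \<open>(v z, w z)\<close>. Its answer is instantiated by the arguments
  and then put into the contexts.\<close>

lemma sim_plug_App:
  assumes sim: "simulates R S T" and T': "S \<subseteq> T'" "T \<subseteq> T'" "subst_closed T'" "up_ectx T' \<subseteq> T'"
    and vw: "(v, w) \<in> rel_v R" and u: "(u, u') \<in> rel_v T'" and E: "(E, E') \<in> rel_c T'"
  shows "sim S' T' (plug E (App (Val v) (Val u))) (plug E' (App (Val w) (Val u')))"
proof -
  obtain z where z: "z \<notin> fvv v" "z \<notin> fvv w"
    "(App (Val v) (Val (Var z)), App (Val w) (Val (Var z))) \<in> R"
    using vw by (auto simp: rel_v_def)
  have "App (Val v) (Val (Var z)) \<noteq> open_stuck F z q" for F q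
    using z(1) plug_App_inject[of Hole v "Var z" F "Var z" q] by (auto simp: open_stuck_def)
  then have "sim T' T' ((App (Val v) (Val (Var z)))\<lbrace>u/z\<rbrace>) ((App (Val w) (Val (Var z)))\<lbrace>u'/z\<rbrace>)"
    using sim_subst[OF simulatesD[OF sim z(3)]] T' u by blast
  then have "sim T' T' (App (Val v) (Val u)) (App (Val w) (Val u'))"
    using z(1,2) by simp
  then show ?thesis using sim_plug T'(3,4) E by blast
qed

lemma simulates_subst:
  assumes sim: "simulates R S T" and incl: "R \<subseteq> S" "S \<subseteq> S'" "S' \<subseteq> T'" "T \<subseteq> T'"
    and closed: "subst_closed S'" "subst_closed T'" "up_ectx T' \<subseteq> T'"
  shows "simulates (up_subst R) S' T'"
proof -
  have "sim S' T' (t\<lbrace>v/x\<rbrace>) (s\<lbrace>w/x\<rbrace>)" if ts: "(t, s) \<in> R" and vw: "(v, w) \<in> rel_v R" for t s v w x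
  proof -
    have vw': "(v, w) \<in> rel_v S'" "(v, w) \<in> rel_v T'"
      using vw incl rel_v_mono by blast+
    show ?thesis
    proof (cases "\<exists>E u. t = open_stuck E x u")
      case True
      then obtain E u where t: "t = open_stuck E x u" by blast
      with simulatesD[OF sim ts] obtain E' u' where
        s: "s \<rightarrow>\<^sub>v\<^sup>* open_stuck E' x u'" and E: "(E, E') \<in> rel_c T" and u: "(u, u') \<in> rel_v T"
        by (auto simp: sim_iff evaluates_open_stuck rel_o_iff)
      \<comment> \<open>Substitution replaces the head by a value \<open>q\<close> that may be an
        abstraction, so the stuck shape may turn into a redex.\<close>
      have *: "(open_stuck F x r)\<lbrace>q/x\<rbrace>
          = plug (subc F (Var(x := q))) (App (Val q) (Val (subst1v r q x)))" for F r q
        by (simp add: open_stuck_def sub_plug)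
      \<comment> \<open>The clause for stuck terms relates contexts and arguments only by
        \<open>T\<close>. This suffices: an application in a context is no value, so its answer is
        measured by \<open>T'\<close>.\<close>
      have "(E, E') \<in> rel_c T'" "(u, u') \<in> rel_v T'"
        using E u incl rel_c_mono rel_v_mono by blast+
      then have "(subc E (Var(x := v)), subc E' (Var(x := w))) \<in> rel_c T'"
        "(subst1v u v x, subst1v u' w x) \<in> rel_v T'"
        using rel_c_subst[OF closed(2) _ vw'(2)] rel_v_subst[OF closed(2) _ vw'(2)] by blast+
      then have "sim S' T' ((open_stuck E x u)\<lbrace>v/x\<rbrace>) ((open_stuck E' x u')\<lbrace>w/x\<rbrace>)"
        unfolding * using sim_plug_App[OF sim _ incl(4) closed(2,3) vw] incl by blast
      then show ?thesis using t sim_antireduce[OF steps_sub[OF s]] by blast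
    next
      case False
      then show ?thesis
        using sim_subst[OF simulatesD[OF sim ts] _ incl(2) closed(1) vw'(1) incl(4) closed(2) vw'(2)]
        by blast
    qed
  qed
  then show ?thesis by (auto simp: simulates_def up_subst_def)
qed

lemma simulates_ectx:
  assumes sim: "simulates R R T" and incl: "R \<subseteq> S'" "S' \<subseteq> T'" "T \<subseteq> T'"
    and closed: "subst_closed S'" "subst_closed T'" "up_ectx T' \<subseteq> T'"
  shows "simulates (up_ectx R) S' T'"
proof -
  have "sim S' T' (plug E t) (plug E' s)" if ts: "(t, s) \<in> R" and E: "(E, E') \<in> rel_c R" for t s E E'
  proof (cases "\<exists>v. t = Val v")
    case True
    then obtain v where t: "t = Val v" by blast
    with simulatesD[OF sim ts] obtain w where s: "s \<rightarrow>\<^sub>v\<^sup>* Val w" and vw: "(v, w) \<in> rel_v R"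
      by (auto simp: sim_iff evaluates_Val)
    obtain x where x: "x \<notin> fvc E" "x \<notin> fvc E'"
      "(plug E (Val (Var x)), plug E' (Val (Var x))) \<in> R"
      using E by (auto simp: rel_c_def)
    \<comment> \<open>\<open>E[v]\<close> is \<open>E[x]\<close> with \<open>v\<close> for the fresh
      \<open>x\<close>. As the clause for values returned \<open>(v, w)\<close> in
      \<open>rel_v R\<close>, the pair is an instance of \<open>up_subst R\<close>.\<close>
    have "((plug E (Val (Var x)))\<lbrace>v/x\<rbrace>, (plug E' (Val (Var x)))\<lbrace>w/x\<rbrace>) \<in> up_subst R"
      using x(3) vw unfolding up_subst_def by blast
    then have "(plug E (Val v), plug E' (Val w)) \<in> up_subst R"
      using x(1,2) by (simp add: sub_plug)
    then have "sim S' T' (plug E (Val v)) (plug E' (Val w))"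
      using simulatesD[OF simulates_subst[OF sim _ incl closed]] by blast
    then show ?thesis using t sim_antireduce[OF steps_plug[OF s]] by blast
  next
    case False
    have "(E, E') \<in> rel_c T'" using E incl rel_c_mono by blast
    then show ?thesis
      using False sim_plug[OF simulatesD[OF sim ts] _ incl(3) closed(2,3)] by blast
  qed
  then show ?thesis by (auto simp: simulates_def up_ectx_def)
qed

section \<open>Closure under converse\<close>

lemma up_refl_converse: "up_refl (R\<inverse>) = (up_refl R)\<inverse>"
  unfolding up_refl_def by auto

lemma up_lam_converse: "up_lam (R\<inverse>) = (up_lam R)\<inverse>"
  unfolding up_lam_def by auto

lemma up_subst_converse: "up_subst (R\<inverse>) = (up_subst R)\<inverse>"
proof -
  have "up_subst (R\<inverse>) \<subseteq> (up_subst R)\<inverse>" for R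
    unfolding up_subst_def rel_v_converse by blast
  from this[of R] this[of "R\<inverse>"] show ?thesis by auto
qed

lemma up_ectx_converse: "up_ectx (R\<inverse>) = (up_ectx R)\<inverse>"
proof -
  have "up_ectx (R\<inverse>) \<subseteq> (up_ectx R)\<inverse>" for R
    unfolding up_ectx_def rel_c_converse by blast
  from this[of R] this[of "R\<inverse>"] show ?thesis by auto
qed

lemma up_red_converse: "up_red (R\<inverse>) = (up_red R)\<inverse>"
  unfolding up_red_def by auto

lemmas up_converse =
  up_refl_converse up_lam_converse up_subst_converse up_ectx_converse up_red_converse

section \<open>Iteration of continuous functions\<close>

lemma subset_omega: "R \<subseteq> omega f R"
proof -
  have "R = (f ^^ 0) R" by simp
  then show ?thesis unfolding omega_def by blast
qed

lemma fun_of_mono: "\<forall>f\<in>G. mono f \<Longrightarrow> mono (fun_of G)"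
  unfolding fun_of_def by (intro monoI UN_mono order_refl) (metis monoD)

text \<open>Together with \<open>subset_omega\<close> and \<open>omega_closed\<close>, this
  identifies the iterate, for monotone continuous functions, as the least relation above
  \<open>X\<close> that is closed under \<open>G\<close>.\<close>

lemma omega_least:
  assumes "\<forall>f\<in>G. mono f" "\<forall>f\<in>G. f Y \<subseteq> Y" "X \<subseteq> Y"
  shows "omega (hat (fun_of G)) X \<subseteq> Y"
proof -
  have "fun_of G Y \<subseteq> Y" using assms(2) by (auto simp: fun_of_def)
  then have *: "Z \<subseteq> Y \<Longrightarrow> hat (fun_of G) Z \<subseteq> Y" for Z
    using monoD[OF fun_of_mono[OF assms(1)], of Z Y] by (auto simp: hat_def)
  have "(hat (fun_of G) ^^ n) X \<subseteq> Y" for n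
  proof (induction n)
    case (Suc n)
    then show ?case using * by simp
  qed (use assms(3) in simp)
  then show ?thesis by (auto simp: omega_def)
qed

text \<open>\<open>hat\<close> adds the identity, so the stages increase and a finite subset of
  their union lies in a single stage. Continuity reduces membership to such a finite subset, and one
  more stage contains the result.\<close>

lemma omega_closed:
  assumes "f \<in> G" "mono f" "continuous_fun f"
  shows "f (omega (hat (fun_of G)) R) \<subseteq> omega (hat (fun_of G)) R"
proof
  define A where "A n = (hat (fun_of G) ^^ n) R" for n
  have \<omega>: "omega (hat (fun_of G)) R = (\<Union>n. A n)"
    by (simp add: omega_def A_def)
  have "A n \<subseteq> A (Suc n)" for n
    by (simp add: A_def hat_def)
  then have A: "m \<le> n \<Longrightarrow> A m \<subseteq> A n" for m n
    by (rule lift_Suc_mono_le)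
  fix p
  assume "p \<in> f (omega (hat (fun_of G)) R)"
  then obtain K where K: "finite K" "K \<subseteq> (\<Union>n. A n)" "p \<in> f K"
    using assms(3) unfolding continuous_fun_def \<omega> by blast
  have "\<exists>n. K \<subseteq> A n"
    using K(1,2)
  proof (induction K)
    case (insert a K)
    then obtain m n where "K \<subseteq> A m" "a \<in> A n" by auto
    then have "insert a K \<subseteq> A (max m n)"
      using A[of m "max m n"] A[of n "max m n"] by auto
    then show ?case by blast
  qed simp
  then obtain n where "K \<subseteq> A n" by blast
  then have "p \<in> f (A n)" using K(3) monoD[OF assms(2)] by blast
  then have "p \<in> A (Suc n)" using assms(1) by (auto simp: A_def hat_def fun_of_def)
  then show "p \<in> omega (hat (fun_of G)) R" using \<omega> by blast
qed

text \<open>Freshness is read existentially, so a single pair of \<open>R\<close> witnesses the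
  test; this is the source of continuity for \<open>up_subst\<close>.\<close>

lemma rel_v_finite:
  assumes "(v, w) \<in> rel_v R"
  obtains p where "p \<in> R" "(v, w) \<in> rel_v {p}"
  using assms unfolding rel_v_def by blast

lemma rel_c_finite:
  assumes "(E, E') \<in> rel_c R"
  obtains p where "p \<in> R" "(E, E') \<in> rel_c {p}"
  using assms unfolding rel_c_def by blast

lemma continuous_funI:
  assumes "\<And>R p. p \<in> f R \<Longrightarrow> \<exists>S\<subseteq>R. finite S \<and> p \<in> f S"
  shows "continuous_fun f"
  unfolding continuous_fun_def
proof (intro allI subsetI)
  fix R p
  assume "p \<in> f R"
  then obtain S where "S \<subseteq> R" "finite S" "p \<in> f S" using assms by meson
  then show "p \<in> \<Union>{f S | S. S \<subseteq> R \<and> finite S}" by auto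
qed

section \<open>Continuity of the up-to functions\<close>

lemma continuous_up_refl: "continuous_fun up_refl"
  by (rule continuous_funI) (auto simp: up_refl_def)

lemma continuous_up_lam: "continuous_fun up_lam"
proof (rule continuous_funI)
  fix R p
  assume "p \<in> up_lam R"
  then obtain x t s where "p = (Val (Abs x t), Val (Abs x s))" "(t, s) \<in> R"
    by (auto simp: up_lam_def)
  then show "\<exists>S\<subseteq>R. finite S \<and> p \<in> up_lam S"
    by (intro exI[of _ "{(t, s)}"]) (auto simp: up_lam_def)
qed

lemma continuous_up_subst: "continuous_fun up_subst"
proof (rule continuous_funI)
  fix R p
  assume "p \<in> up_subst R"
  then obtain t s v w x where p: "p = (t\<lbrace>v/x\<rbrace>, s\<lbrace>w/x\<rbrace>)" "(t, s) \<in> R" "(v, w) \<in> rel_v R"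
    by (auto simp: up_subst_def)
  obtain q where q: "q \<in> R" "(v, w) \<in> rel_v {q}" using p(3) by (rule rel_v_finite)
  have "(v, w) \<in> rel_v {(t, s), q}" using q(2) rel_v_mono[of "{q}" "{(t, s), q}"] by blast
  then have "p \<in> up_subst {(t, s), q}" using p(1) unfolding up_subst_def by blast
  then show "\<exists>S\<subseteq>R. finite S \<and> p \<in> up_subst S"
    using p(2) q(1) by (intro exI[of _ "{(t, s), q}"]) auto
qed

lemma continuous_up_ectx: "continuous_fun up_ectx"
proof (rule continuous_funI)
  fix R p
  assume "p \<in> up_ectx R"
  then obtain E E' t s where p: "p = (plug E t, plug E' s)" "(t, s) \<in> R" "(E, E') \<in> rel_c R"
    by (auto simp: up_ectx_def)
  obtain q where q: "q \<in> R" "(E, E') \<in> rel_c {q}" using p(3) by (rule rel_c_finite)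
  have "(E, E') \<in> rel_c {(t, s), q}" using q(2) rel_c_mono[of "{q}" "{(t, s), q}"] by blast
  then have "p \<in> up_ectx {(t, s), q}" using p(1) unfolding up_ectx_def by blast
  then show "\<exists>S\<subseteq>R. finite S \<and> p \<in> up_ectx S"
    using p(2) q(1) by (intro exI[of _ "{(t, s), q}"]) auto
qed

lemma continuous_id: "continuous_fun id"
proof (rule continuous_funI)
  fix R :: trel and p
  assume "p \<in> id R"
  then show "\<exists>S\<subseteq>R. finite S \<and> p \<in> id S" by (intro exI[of _ "{p}"]) auto
qed

lemma continuous_up_red: "continuous_fun up_red"
proof (rule continuous_funI)
  fix R p
  assume "p \<in> up_red R"
  then obtain t s t' s' where "p = (t, s)" "t \<rightarrow>\<^sub>v\<^sup>* t'" "s \<rightarrow>\<^sub>v\<^sup>* s'" "(t', s') \<in> R"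
    by (auto simp: up_red_def)
  then show "\<exists>S\<subseteq>R. finite S \<and> p \<in> up_red S"
    by (intro exI[of _ "{(t', s')}"]) (auto simp: up_red_def)
qed

section \<open>Compatibility\<close>

definition strong_fns :: "rfun set" where
  "strong_fns = {up_refl, up_lam, up_subst, id, up_red}"

definition all_fns :: "rfun set" where
  "all_fns = {up_refl, up_lam, up_subst, up_ectx, id, up_red}"

lemma strong_fns_subset: "strong_fns \<subseteq> all_fns"
  by (auto simp: strong_fns_def all_fns_def)

abbreviation "S\<omega> \<equiv> omega (hat (fun_of strong_fns))"
abbreviation "F\<omega> \<equiv> omega (hat (fun_of all_fns))"

lemma all_fns_continuous: "\<forall>f\<in>all_fns. continuous_fun f"
  by (simp add: all_fns_def continuous_up_refl continuous_up_lam continuous_up_subst continuous_up_ectx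
      continuous_id continuous_up_red)

lemma all_fns_mono: "\<forall>f\<in>all_fns. mono f"
proof -
  have "mono up_refl" by (rule monoI) (simp add: up_refl_def)
  moreover have "mono up_lam" unfolding mono_def up_lam_def by blast
  moreover have "mono up_subst"
  proof (rule monoI)
    fix R S :: trel
    assume "R \<subseteq> S"
    then show "up_subst R \<subseteq> up_subst S"
      using rel_v_mono[of R S] unfolding up_subst_def by blast
  qed
  moreover have "mono up_ectx"
  proof (rule monoI)
    fix R S :: trel
    assume "R \<subseteq> S"
    then show "up_ectx R \<subseteq> up_ectx S"
      using rel_c_mono[of R S] unfolding up_ectx_def by blast
  qed
  moreover have "mono (id :: rfun)" by (rule monoI) simp
  moreover have "mono up_red" unfolding mono_def up_red_def by blast
  ultimately show ?thesis by (simp add: all_fns_def)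
qed

lemma all_fns_converse:
  assumes "f \<in> all_fns"
  shows "f (R\<inverse>) = (f R)\<inverse>"
  using assms unfolding all_fns_def by (auto simp only: up_converse id_apply)

definition closed_under :: "rfun set \<Rightarrow> trel \<Rightarrow> bool" where
  "closed_under G R \<longleftrightarrow> (\<forall>f\<in>G. f R \<subseteq> R)"

lemma closed_under_converse:
  assumes "G \<subseteq> all_fns" "closed_under G R"
  shows "closed_under G (R\<inverse>)"
  unfolding closed_under_def
proof
  fix f
  assume f: "f \<in> G"
  then have "f (R\<inverse>) = (f R)\<inverse>" using assms(1) all_fns_converse by (meson subsetD)
  moreover have "f R \<subseteq> R" using assms(2) f by (simp add: closed_under_def)
  ultimately show "f (R\<inverse>) \<subseteq> R\<inverse>" by (simp only: converse_mono)
qed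

lemma closed_under_subset: "closed_under H R \<Longrightarrow> G \<subseteq> H \<Longrightarrow> closed_under G R"
  unfolding closed_under_def by (meson subsetD)

lemma closed_under_strong_fns:
  "closed_under strong_fns R \<longleftrightarrow> subst_closed R \<and> up_lam R \<subseteq> R \<and> up_red R \<subseteq> R"
  by (auto simp only: closed_under_def strong_fns_def subst_closed_def ball_simps id_apply)

lemma closed_under_all_fns:
  "closed_under all_fns R \<longleftrightarrow> closed_under strong_fns R \<and> up_ectx R \<subseteq> R"
  by (auto simp only: closed_under_def strong_fns_def all_fns_def ball_simps)

lemma F\<omega>_closed: "closed_under all_fns (F\<omega> R)"
  unfolding closed_under_def
proof
  fix f
  assume f: "f \<in> all_fns"
  show "f (F\<omega> R) \<subseteq> F\<omega> R"
    using omega_closed[OF f bspec[OF all_fns_mono f] bspec[OF all_fns_continuous f]] .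
qed

lemma S\<omega>_closed: "closed_under strong_fns (S\<omega> R)"
  unfolding closed_under_def
proof
  fix f
  assume f: "f \<in> strong_fns"
  then have f': "f \<in> all_fns" using strong_fns_subset by (rule rev_subsetD)
  show "f (S\<omega> R) \<subseteq> S\<omega> R"
    using omega_closed[OF f bspec[OF all_fns_mono f'] bspec[OF all_fns_continuous f']] .
qed

lemma S\<omega>_subset_F\<omega>:
  assumes "R \<subseteq> F\<omega> T"
  shows "S\<omega> R \<subseteq> F\<omega> T"
proof (rule omega_least)
  show "\<forall>f\<in>strong_fns. mono f" using all_fns_mono strong_fns_subset by (meson subsetD)
  show "\<forall>f\<in>strong_fns. f (F\<omega> T) \<subseteq> F\<omega> T"
    using closed_under_subset[OF F\<omega>_closed strong_fns_subset] by (simp add: closed_under_def)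
qed (rule assms)

text \<open>The bounds are arbitrary closed relations, not iterates, because the lemma serves both
  directions of the game: the converses of the iterates are closed too.\<close>

lemma simulates_strong_fns:
  assumes f: "f \<in> strong_fns" and sim: "simulates R S T"
    and incl: "R \<subseteq> S" "S \<subseteq> S'" "S' \<subseteq> T'" "T \<subseteq> T'"
    and closed: "closed_under strong_fns S'" "closed_under all_fns T'"
  shows "simulates (f R) S' T'"
proof -
  have S': "subst_closed S'" "up_refl S' \<subseteq> S'" "up_red S' \<subseteq> S'"
    and T': "subst_closed T'" "up_refl T' \<subseteq> T'" "up_red T' \<subseteq> T'" "up_ectx T' \<subseteq> T'"
    using closed by (simp_all add: closed_under_all_fns closed_under_strong_fns subst_closed_def)
  have R: "R \<subseteq> S'" "R \<subseteq> T'" using incl by blast+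
  consider "f = up_refl" | "f = up_lam" | "f = up_subst" | "f = id" | "f = up_red"
    using f unfolding strong_fns_def by blast
  then show ?thesis
  proof cases
    case 1
    then show ?thesis using simulates_refl[OF S'(2) T'(2)] by simp
  next
    case 2
    then show ?thesis using simulates_lam[OF R(1) S'(3)] by simp
  next
    case 3
    then show ?thesis using simulates_subst[OF sim incl S'(1) T'(1,4)] by simp
  next
    case 4
    then show ?thesis using sim sim_mono[OF _ incl(2,4)] by (auto simp: simulates_def)
  next
    case 5
    then show ?thesis using simulates_red[OF sim incl(2,4) R(2) T'(3)] by simp
  qed
qed

lemma strongly_evolves_strong_fns:
  assumes "f \<in> strong_fns"
  shows "strongly_evolves f S\<omega> F\<omega>"
  unfolding strongly_evolves_def
proof (intro allI impI)
  fix R S T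
  assume "progress R S T"
  then have RS: "R \<subseteq> S" and ST: "S \<subseteq> T"
    and sim: "simulates R S T" "simulates (R\<inverse>) (S\<inverse>) (T\<inverse>)"
    by (simp_all add: progress_iff)
  let ?S = "S\<omega> S" and ?T = "F\<omega> T"
  have f: "f \<in> all_fns" using strong_fns_subset assms by (rule subsetD)
  have SS: "S \<subseteq> ?S" and TT: "T \<subseteq> ?T" by (rule subset_omega)+
  have SST: "?S \<subseteq> ?T" using S\<omega>_subset_F\<omega> order_trans[OF ST TT] .
  have "f R \<subseteq> f ?S"
    using monoD[OF bspec[OF all_fns_mono f] order_trans[OF RS SS]] .
  also have "\<dots> \<subseteq> ?S"
    using S\<omega>_closed assms by (simp add: closed_under_def)
  finally have "f R \<subseteq> ?S" .
  moreover have "simulates (f R) ?S ?T"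
    using simulates_strong_fns[OF assms sim(1) RS SS SST TT S\<omega>_closed F\<omega>_closed] .
  moreover have "simulates (f (R\<inverse>)) (?S\<inverse>) (?T\<inverse>)"
    by (rule simulates_strong_fns[OF assms sim(2)])
      (simp_all only: converse_mono RS SS SST TT S\<omega>_closed F\<omega>_closed closed_under_converse
        strong_fns_subset order_refl)
  ultimately show "progress (f R) ?S ?T"
    using SST by (simp add: progress_iff all_fns_converse[OF f])
qed

lemma evolves_all_fns:
  assumes "f \<in> all_fns"
  shows "evolves f (S\<omega> \<circ> hat (fun_of all_fns) \<circ> S\<omega>) F\<omega>"
  unfolding evolves_def
proof (intro allI impI)
  fix R T
  assume p: "progress R R T"
  then have RT: "R \<subseteq> T" and sim: "simulates R R T" "simulates (R\<inverse>) (R\<inverse>) (T\<inverse>)"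
    by (simp_all add: progress_iff)
  let ?S = "S\<omega> R" and ?T = "F\<omega> T" and ?P = "(S\<omega> \<circ> hat (fun_of all_fns) \<circ> S\<omega>) R"
  have RS: "R \<subseteq> ?S" and TT: "T \<subseteq> ?T" by (rule subset_omega)+
  have ST: "?S \<subseteq> ?T" using S\<omega>_subset_F\<omega> order_trans[OF RT TT] .
  have hatS: "hat (fun_of all_fns) ?S \<subseteq> ?P" by (simp add: subset_omega)
  then have SP: "?S \<subseteq> ?P" by (auto simp: hat_def)
  have "g ?S \<subseteq> ?T" if g: "g \<in> all_fns" for g
  proof -
    have "g ?S \<subseteq> g ?T" using monoD[OF bspec[OF all_fns_mono g] ST] .
    also have "\<dots> \<subseteq> ?T" using F\<omega>_closed g by (simp add: closed_under_def)
    finally show ?thesis .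
  qed
  then have "hat (fun_of all_fns) ?S \<subseteq> ?T"
    using ST unfolding hat_def fun_of_def by auto
  then have PT: "?P \<subseteq> ?T" using S\<omega>_subset_F\<omega> by simp
  show "progress (f R) ?P ?T"
  proof (cases "f = up_ectx")
    case False
    then have "f \<in> strong_fns" using assms by (auto simp: strong_fns_def all_fns_def)
    then have "progress (f R) ?S ?T"
      using p strongly_evolves_strong_fns[of f] unfolding strongly_evolves_def by blast
    then show ?thesis by (rule progress_mono[OF _ SP order_refl PT])
  next
    case True
    have sim_ectx: "simulates (up_ectx R') S' T'"
      if "simulates R' R' T''" "R' \<subseteq> S'" "S' \<subseteq> T'" "T'' \<subseteq> T'"
        "closed_under strong_fns S'" "closed_under all_fns T'" for R' S' T' T''
      using that simulates_ectx by (simp add: closed_under_all_fns closed_under_strong_fns)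
    have "simulates (up_ectx R) ?S ?T"
      using sim_ectx[OF sim(1) RS ST TT S\<omega>_closed F\<omega>_closed] .
    moreover have "simulates (up_ectx (R\<inverse>)) (?S\<inverse>) (?T\<inverse>)"
      by (rule sim_ectx[OF sim(2)])
        (simp_all only: converse_mono RS ST TT S\<omega>_closed F\<omega>_closed closed_under_converse
          strong_fns_subset order_refl)
    ultimately have "simulates (up_ectx R) ?P ?T" "simulates ((up_ectx R)\<inverse>) (?P\<inverse>) (?T\<inverse>)"
      using sim_mono[OF _ SP order_refl] sim_mono[OF _ iffD2[OF converse_mono SP] order_refl]
      unfolding simulates_def up_ectx_converse by blast+
    moreover have "up_ectx R \<subseteq> up_ectx ?S"
      using monoD[OF bspec[OF all_fns_mono assms] RS] True by simp
    \<comment> \<open>The clauses of the game hold with \<open>S\<omega> R\<close> as passive bound.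
      Progress also asks that \<open>up_ectx R\<close> lie within its passive bound, which the
      middle factor of \<open>?P\<close> provides.\<close>
    then have "up_ectx R \<subseteq> ?P"
      using hatS assms True unfolding hat_def fun_of_def by blast
    ultimately show ?thesis using True PT by (simp add: progress_iff)
  qed
qed

section \<open>\<open>up_ectx\<close> is not a strong function\<close>

lemma not_strongly_evolves_up_ectx: "\<not> strongly_evolves up_ectx g h"
proof
  assume evo: "strongly_evolves up_ectx g h"
  define R where "R = insert (Val (Var 0), Val (Var 1)) Id"
  \<comment> \<open>Over the full relation a test asks only for a fresh name, so any two values pass
    the clause for values, in particular the two distinct variables in \<open>R\<close>.\<close>
  have UN: "rel_v UNIV = UNIV" "rel_c UNIV = UNIV"
    using ex_new_if_finite[OF infinite_UNIV_nat, of "fvv _ \<union> fvv _"]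
      ex_new_if_finite[OF infinite_UNIV_nat, of "fvc _ \<union> fvc _"]
    by (auto simp: rel_v_def rel_c_def finite_fv)
  have "sim UNIV UNIV t s" if "t = s \<or> (\<exists>v w. t = Val v \<and> s = Val w)" for t s
    using that by (cases t rule: tm_trichotomy) (auto simp: UN intro: sim.intros)
  then have "progress R UNIV UNIV"
    by (auto simp: progress_iff simulates_def R_def)
  then have "progress (up_ectx R) (g UNIV) (h UNIV)"
    using evo by (simp add: strongly_evolves_def)
  then have sim: "simulates (up_ectx R) (g UNIV) (h UNIV)"
    by (simp add: progress_iff)
  \<comment> \<open>The hole is in function position, so plugging the two variables gives stuck
    terms with different heads.\<close>
  let ?E = "CtxL Hole (Val (Var 0))"
  have "up_refl R \<subseteq> R" by (auto simp: up_refl_def R_def)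
  then have "(?E, ?E) \<in> rel_c R" by (rule rel_c_refl)
  then have "(plug ?E (Val (Var 0)), plug ?E (Val (Var 1))) \<in> up_ectx R"
    unfolding up_ectx_def R_def by blast
  moreover have "plug ?E (Val (Var n)) = open_stuck Hole n (Var 0)" for n
    by (simp add: open_stuck_def)
  ultimately have "sim (g UNIV) (h UNIV) (open_stuck Hole 0 (Var 0)) (open_stuck Hole 1 (Var 0))"
    using simulatesD[OF sim] by simp
  then obtain E' w where "open_stuck Hole 1 (Var 0) \<rightarrow>\<^sub>v\<^sup>* open_stuck E' 0 w"
    by (auto simp: sim_iff evaluates_open_stuck)
  \<comment> \<open>The right term is irreducible with head 1, so it cannot reach a term stuck on
    0.\<close>
  then show False by (cases rule: converse_rtranclpE) auto
qed

lemma strong_subset_strong_fns: "strong_subset all_fns strong_fns"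
  unfolding strong_subset_def
  using strong_fns_subset strongly_evolves_strong_fns evolves_all_fns by blast

lemma strong_all_fns: "strong all_fns = all_fns - {up_ectx}"
proof -
  \<comment> \<open>Having no strong evolution keeps \<open>up_ectx\<close> out of every admissible
    \<open>S\<close>. Its distinctness from the functions in \<open>strong_fns\<close> follows as
    well, without comparing values of the functions.\<close>
  have "up_ectx \<notin> S" "S \<subseteq> all_fns" if "strong_subset all_fns S" for S
    using that not_strongly_evolves_up_ectx unfolding strong_subset_def by blast+
  then have "strong all_fns \<subseteq> all_fns - {up_ectx}"
    unfolding Defs.strong_def by blast
  moreover have "all_fns - {up_ectx} \<subseteq> strong_fns"
    by (auto simp: all_fns_def strong_fns_def)
  then have "all_fns - {up_ectx} \<subseteq> strong all_fns"
    using strong_subset_strong_fns unfolding Defs.strong_def by blast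
  ultimately show ?thesis by blast
qed

theorem theorem3p21:
  "diacritically_compatible {up_refl, up_lam, up_subst, up_ectx, id, up_red} \<and>
   strong {up_refl, up_lam, up_subst, up_ectx, id, up_red} =
     {up_refl, up_lam, up_subst, up_ectx, id, up_red} - {up_ectx}"
  unfolding all_fns_def[symmetric] diacritically_compatible_def
  using all_fns_continuous strong_subset_strong_fns strong_all_fns by blast

end
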